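(* Let $(A,\mu,\alpha)$ be a multiplicative Hom-alternative algebra over $\mathbf{k}$, and write $xy=\mu(x,y)$. Then $A^+_T = (A,\{,,\},\alpha^2)$ is a multiplicative Hom-Jordan triple system (with both twisting maps equal to $\alpha^2$), where $$\{xyz\} = \frac{1}{2}\left(\alpha(x)(yz) + \alpha(z)(yx)\right)$$ for $x,y,z\in A$.
   Context: $\mathbf{k}$ is a fixed field of characteristic $0$; $\alpha^k$ denotes $k$-fold composition. A multiplicative Hom-algebra $(A,\mu,\alpha)$ is a $\mathbf{k}$-module $A$ with a bilinear map $\mu\colon A\otimes A\to A$ (no associativity assumed) and a linear map $\alpha\colon A\to A$ such that $\alpha(\mu(x,y))=\mu(\alpha(x),\alpha(y))$. Its Hom-associator is $as_A(x,y,z) = (xy)\alpha(z) - \alpha(x)(yz)$. A Hom-alternative algebra is a Hom-algebra whose Hom-associator is anti-symmetric in its three arguments (permuting the arguments by $\sigma$ multiplies $as_A$ by the sign of $\sigma$). A Hom-Jordan triple system $(J,\{,,\},(\alpha_1,\alpha_2))$ is a $\mathbf{k}$-module $J$ with a trilinear map $\{,,\}\colon J^{\otimes 3}\to J$ and linear maps $\alpha_1,\alpha_2\colon J\to J$ (the twisting maps) such that, for all $u,v,w,x,y,z\in J$, $\{xyz\}=\{zyx\}$ and $$\{\alpha_1(x)\,\alpha_2(y)\,\{uvw\}\} - \{\alpha_1(u)\,\alpha_2(v)\,\{xyw\}\} = \{\{xyu\}\,\alpha_1(v)\,\alpha_2(w)\} - \{\alpha_1(u)\,\{yxv\}\,\alpha_2(w)\}.$$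 When $\alpha_1=\alpha_2=\gamma$ it is written $(J,\{,,\},\gamma)$; it is multiplicative if $\alpha_1=\alpha_2=\gamma$ and $\gamma(\{xyz\})=\{\gamma(x)\gamma(y)\gamma(z)\}$ for all $x,y,z$. *)

theory Defs
  imports Complex_Main "HOL-Combinatorics.Permutations"
begin

locale hom_algebra = vector_space scale
  for scale :: "'k::field_char_0 \<Rightarrow> 'a::ab_group_add \<Rightarrow> 'a" +
  fixes \<mu> :: "'a \<Rightarrow> 'a \<Rightarrow> 'a"
    and \<alpha> :: "'a \<Rightarrow> 'a"
  assumes linear_mult_right: "Vector_Spaces.linear scale scale (\<lambda>y. \<mu> x y)"
    and linear_mult_left: "Vector_Spaces.linear scale scale (\<lambda>x. \<mu> x y)"
    and linear_twist: "Vector_Spaces.linear scale scale \<alpha>"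
begin

definition hom_associator :: "'a \<Rightarrow> 'a \<Rightarrow> 'a \<Rightarrow> 'a" where
  "hom_associator x y z = \<mu> (\<mu> x y) (\<alpha> z) - \<mu> (\<alpha> x) (\<mu> y z)"

end

locale multiplicative_hom_algebra = hom_algebra +
  assumes twist_mult: "\<alpha> (\<mu> x y) = \<mu> (\<alpha> x) (\<alpha> y)"

text \<open>The three arguments of the Hom-associator are indexed by 0, 1, 2, and a permutation
  of the arguments is a permutation of these indices.\<close>

locale hom_alternative_algebra = hom_algebra +
  assumes hom_associator_permute:
    "\<sigma> permutes {0, 1, 2::nat} \<Longrightarrow>
      hom_associator (x (\<sigma> 0)) (x (\<sigma> 1)) (x (\<sigma> 2)) =
        scale (of_int (sign \<sigma>)) (hom_associator (x 0) (x 1) (x 2))"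

locale multiplicative_hom_alternative_algebra =
  multiplicative_hom_algebra + hom_alternative_algebra

locale hom_jordan_triple_system = vector_space scale
  for scale :: "'k::field_char_0 \<Rightarrow> 'a::ab_group_add \<Rightarrow> 'a" +
  fixes T :: "'a \<Rightarrow> 'a \<Rightarrow> 'a \<Rightarrow> 'a"
    and \<alpha>1 :: "'a \<Rightarrow> 'a"
    and \<alpha>2 :: "'a \<Rightarrow> 'a"
  assumes linear_triple_1: "Vector_Spaces.linear scale scale (\<lambda>x. T x y z)"
    and linear_triple_2: "Vector_Spaces.linear scale scale (\<lambda>y. T x y z)"
    and linear_triple_3: "Vector_Spaces.linear scale scale (\<lambda>z. T x y z)"
    and linear_twist_1: "Vector_Spaces.linear scale scale \<alpha>1"
    and linear_twist_2: "Vector_Spaces.linear scale scale \<alpha>2"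
    and triple_symmetric: "T x y z = T z y x"
    and hom_jordan_triple_identity:
      "T (\<alpha>1 x) (\<alpha>2 y) (T u v w) - T (\<alpha>1 u) (\<alpha>2 v) (T x y w) =
        T (T x y u) (\<alpha>1 v) (\<alpha>2 w) - T (\<alpha>1 u) (T y x v) (\<alpha>2 w)"

locale multiplicative_hom_jordan_triple_system = hom_jordan_triple_system +
  assumes twists_equal: "\<alpha>1 = \<alpha>2"
    and twist_triple: "\<alpha>1 (T x y z) = T (\<alpha>1 x) (\<alpha>1 y) (\<alpha>1 z)"

end

theory Submission
  imports Defs "HOL-Library.Function_Algebras"
begin

text \<open>
  The twists are removed by passing to a larger, untwisted algebra. In a Hom-monomial a leaf at
  depth \<open>d\<close> of a product tree with \<open>m\<close> leaves naturally carries the factor \<open>\<alpha>\<close> to the power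
  \<open>m - 1 - d\<close>. This convention is built into a product: on a direct product of copies of \<open>A\<close>
  indexed by degrees \<open>1, 2, \<dots>\<close>, an element \<open>a\<close> of degree \<open>m\<close> and an element \<open>b\<close> of degree \<open>n\<close>
  are multiplied to \<open>\<mu> ((\<alpha> ^^ (n - 1)) a) ((\<alpha> ^^ (m - 1)) b)\<close> in degree
  \<open>m + n\<close>. Because \<open>\<alpha>\<close> is multiplicative, the ordinary associator of this graded product has, in
  each degree, a sum of Hom-associators of \<open>A\<close> as its component
  (\<open>graded_associator\<close>). Hence the graded ring is alternative in the usual sense. For elements of
  degree 1 its Jordan triple product is the Hom-triple product of \<open>A\<close>, and nesting two triple
  products of such elements produces exactly the powers \<open>\<alpha> ^^ 2\<close> of the Hom-Jordan triple identity.
  So that identity is the degree 5 component of the classical one.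

  In an alternative ring, let \<open>T\<^sub>c a = ca + ac\<close> and let \<open>{xyz} = x(yz) + z(yx)\<close> (twice the usual
  triple product). Call \<open>(D, D')\<close> a structural pair if
  \<open>D{uvw} = {(Du)vw} + {u(D'v)w} + {uv(Dw)}\<close>. Structural pairs are closed under sums and
  commutators. The Jordan triple identity says that \<open>({xy-}, -{yx-})\<close> is a structural pair.
  The middle Moufang identity shows that \<open>(T\<^sub>c, -T\<^sub>c)\<close> is one (\<open>jordan_mult_triple\<close>), and
  \<open>2{xyz} = [T\<^sub>x, T\<^sub>y]z + T\<^bsub>T\<^sub>x y\<^esub> z\<close> (\<open>twice_triple\<close>) expresses the operator \<open>{xy-}\<close> through
  these; exchanging \<open>x\<close> and \<open>y\<close> reverses the sign of the commutator only, which accounts for the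
  companion \<open>-{yx-}\<close>.
\<close>

section \<open>Jordan triple products in alternative rings\<close>

text \<open>Skew-symmetry of the associator yields the alternative laws, in which two arguments
  are equal, once 2 can be cancelled; the Moufang identities below depend on these.\<close>

locale alternative_ring =
  fixes mult :: "'b::ab_group_add \<Rightarrow> 'b \<Rightarrow> 'b" (infixl "\<cdot>" 70)
  assumes add_mult: "(a + b) \<cdot> c = a \<cdot> c + b \<cdot> c"
    and mult_add: "a \<cdot> (b + c) = a \<cdot> b + a \<cdot> c"
    and skew_left: "(a \<cdot> b) \<cdot> c - a \<cdot> (b \<cdot> c) = - ((b \<cdot> a) \<cdot> c - b \<cdot> (a \<cdot> c))"
    and skew_right: "(a \<cdot> b) \<cdot> c - a \<cdot> (b \<cdot> c) = - ((a \<cdot> c) \<cdot> b - a \<cdot> (c \<cdot> b))"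
    and no_two_torsion: "a + a = 0 \<Longrightarrow> a = 0"
begin

lemma mult_minus: "a \<cdot> (- b) = - (a \<cdot> b)"
  by (metis add.right_inverse add_cancel_right_right mult_add eq_neg_iff_add_eq_0 add.commute)

lemma minus_mult: "(- a) \<cdot> b = - (a \<cdot> b)"
  by (metis add.right_inverse add_cancel_right_right add_mult eq_neg_iff_add_eq_0 add.commute)

lemma mult_diff: "a \<cdot> (b - c) = a \<cdot> b - a \<cdot> c"
  using mult_add[of a b "- c"] by (simp add: mult_minus)

lemma diff_mult: "(a - b) \<cdot> c = a \<cdot> c - b \<cdot> c"
  using add_mult[of a "- b" c] by (simp add: minus_mult)

lemmas distribs = add_mult mult_add mult_diff diff_mult mult_minus minus_mult

definition associator :: "'b \<Rightarrow> 'b \<Rightarrow> 'b \<Rightarrow> 'b" where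
  "associator a b c = (a \<cdot> b) \<cdot> c - a \<cdot> (b \<cdot> c)"

lemma associator_swap_left: "associator b a c = - associator a b c"
  using skew_left[of a b c] unfolding associator_def by simp

lemma associator_swap_right: "associator a c b = - associator a b c"
  using skew_right[of a b c] unfolding associator_def by simp

lemma associator_rotate: "associator b c a = associator a b c"
  using associator_swap_left[of b a c] associator_swap_right[of b a c] by simp

lemma left_alternative: "(a \<cdot> a) \<cdot> b = a \<cdot> (a \<cdot> b)"
proof -
  have "associator a a b = - associator a a b" by (rule associator_swap_left)
  then have "associator a a b + associator a a b = 0" by (simp add: eq_neg_iff_add_eq_0)
  then have "associator a a b = 0" by (rule no_two_torsion)
  then show ?thesis by (simp add: associator_def)
qed

lemma flexible: "(a \<cdot> b) \<cdot> a = a \<cdot> (b \<cdot> a)"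
proof -
  have "associator a a b = 0" by (simp add: associator_def left_alternative)
  then have "associator a b a = 0" using associator_swap_right[of a b a] by simp
  then show ?thesis by (simp add: associator_def)
qed

text \<open>All associators that occur have \<open>a\<close> in two places. Skew-symmetry moves both copies to
  the left, where the left alternative law reduces everything to products with \<open>a \<cdot> a\<close>; the
  remaining terms cancel because the associator of \<open>a \<cdot> a\<close> (or of \<open>a\<close>) with \<open>b, c\<close> is skew
  in \<open>b, c\<close>.\<close>

lemma left_Moufang: "(a \<cdot> (b \<cdot> a)) \<cdot> c = a \<cdot> (b \<cdot> (a \<cdot> c))"
proof -
  have "(a \<cdot> (b \<cdot> a)) \<cdot> c - a \<cdot> (b \<cdot> (a \<cdot> c))
      = associator (a \<cdot> b) a c + associator a b (a \<cdot> c)"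
    by (simp add: associator_def flexible)
  also have "\<dots> = - (associator a (a \<cdot> b) c + associator a (a \<cdot> c) b)"
    using associator_swap_left[of "a \<cdot> b" a c] associator_swap_right[of a b "a \<cdot> c"]
    by simp
  also have "\<dots> = a \<cdot> ((a \<cdot> b) \<cdot> c + (a \<cdot> c) \<cdot> b)
      - (((a \<cdot> a) \<cdot> b) \<cdot> c + ((a \<cdot> a) \<cdot> c) \<cdot> b)"
    by (simp add: associator_def left_alternative distribs)
  also have "((a \<cdot> a) \<cdot> b) \<cdot> c + ((a \<cdot> a) \<cdot> c) \<cdot> b = (a \<cdot> a) \<cdot> (b \<cdot> c + c \<cdot> b)"
    using associator_swap_right[of "a \<cdot> a" b c]
    by (simp add: associator_def distribs algebra_simps)
  also have "\<dots> = a \<cdot> (a \<cdot> (b \<cdot> c + c \<cdot> b))" by (rule left_alternative)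
  also have "a \<cdot> (b \<cdot> c + c \<cdot> b) = (a \<cdot> b) \<cdot> c + (a \<cdot> c) \<cdot> b"
    using associator_swap_right[of a b c]
    by (simp add: associator_def distribs algebra_simps)
  finally show ?thesis by simp
qed

text \<open>Left Moufang absorbs the one product of the form \<open>(a \<cdot> (c \<cdot> a)) \<cdot> b\<close> that arises when the
  last two arguments of the associator of \<open>a, b, c \<cdot> a\<close> are exchanged; afterwards \<open>a\<close> can be
  factored out on the left.\<close>

lemma middle_Moufang: "(a \<cdot> b) \<cdot> (c \<cdot> a) = a \<cdot> ((b \<cdot> c) \<cdot> a)"
proof -
  have "(a \<cdot> b) \<cdot> (c \<cdot> a) = associator a b (c \<cdot> a) + a \<cdot> (b \<cdot> (c \<cdot> a))"
    by (simp add: associator_def)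
  also have "\<dots> = a \<cdot> (b \<cdot> (c \<cdot> a)) - associator a (c \<cdot> a) b"
    using associator_swap_right[of a b "c \<cdot> a"] by simp
  also have "\<dots> = a \<cdot> (b \<cdot> (c \<cdot> a)) + a \<cdot> ((c \<cdot> a) \<cdot> b) - a \<cdot> (c \<cdot> (a \<cdot> b))"
    by (simp add: associator_def left_Moufang algebra_simps)
  also have "\<dots> = a \<cdot> (b \<cdot> (c \<cdot> a) + associator c a b)"
    by (simp add: associator_def distribs)
  also have "associator c a b = associator b c a" by (rule associator_rotate)
  finally show ?thesis by (simp add: associator_def)
qed

lemma middle_Moufang_linear:
  "(a \<cdot> b) \<cdot> (c \<cdot> d) + (d \<cdot> b) \<cdot> (c \<cdot> a) = a \<cdot> ((b \<cdot> c) \<cdot> d) + d \<cdot> ((b \<cdot> c) \<cdot> a)"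
  using middle_Moufang[of "a + d" b c] middle_Moufang[of a b c] middle_Moufang[of d b c]
  by (simp add: distribs algebra_simps)

definition jordan_mult :: "'b \<Rightarrow> 'b \<Rightarrow> 'b" where
  "jordan_mult a b = a \<cdot> b + b \<cdot> a"

definition triple :: "'b \<Rightarrow> 'b \<Rightarrow> 'b \<Rightarrow> 'b" where
  "triple a b c = a \<cdot> (b \<cdot> c) + c \<cdot> (b \<cdot> a)"

lemma jordan_mult_commute: "jordan_mult a b = jordan_mult b a"
  by (simp add: jordan_mult_def add.commute)

text \<open>The difference of the two sides is the difference of the associators of \<open>c, a, b\<close> and
  of \<open>a, b, c\<close>, which agree by cyclic symmetry. This is one of the infinitesimal triality
  relations.\<close>

lemma jordan_mult_mult: "jordan_mult c (a \<cdot> b) = (c \<cdot> a) \<cdot> b + a \<cdot> (b \<cdot> c)"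
  using associator_rotate[of a b c]
  by (simp add: jordan_mult_def associator_def algebra_simps)

text \<open>Each of the two summands \<open>u \<cdot> (v \<cdot> w)\<close> and \<open>w \<cdot> (v \<cdot> u)\<close> of the triple product
  satisfies the identity only up to a defect \<open>(u \<cdot> c) \<cdot> (v \<cdot> w) - u \<cdot> ((c \<cdot> v) \<cdot> w)\<close>. The
  linearised middle Moufang identity says that this defect is skew in \<open>u\<close> and \<open>w\<close>, so the
  two defects cancel.\<close>

lemma jordan_mult_triple:
  "jordan_mult c (triple u v w)
    = triple (jordan_mult c u) v w - triple u (jordan_mult c v) w + triple u v (jordan_mult c w)"
proof -
  have half: "(jordan_mult c u) \<cdot> (v \<cdot> w) - u \<cdot> (jordan_mult c v \<cdot> w) + u \<cdot> (v \<cdot> jordan_mult c w)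
      = jordan_mult c (u \<cdot> (v \<cdot> w)) + ((u \<cdot> c) \<cdot> (v \<cdot> w) - u \<cdot> ((c \<cdot> v) \<cdot> w))" for u v w
  proof -
    have "associator v c w + associator v w c = 0"
      using associator_swap_right[of v c w] by simp
    then have "(v \<cdot> c) \<cdot> w = v \<cdot> (c \<cdot> w) + v \<cdot> (w \<cdot> c) - (v \<cdot> w) \<cdot> c"
      by (simp add: associator_def algebra_simps)
    then have "u \<cdot> ((v \<cdot> c) \<cdot> w)
        = u \<cdot> (v \<cdot> (c \<cdot> w)) + u \<cdot> (v \<cdot> (w \<cdot> c)) - u \<cdot> ((v \<cdot> w) \<cdot> c)"
      by (simp only: distribs)
    then show ?thesis
      by (simp add: jordan_mult_mult) (simp add: jordan_mult_def distribs algebra_simps)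
  qed
  let ?defect = "\<lambda>u w. (u \<cdot> c) \<cdot> (v \<cdot> w) - u \<cdot> ((c \<cdot> v) \<cdot> w)"
  have "triple (jordan_mult c u) v w - triple u (jordan_mult c v) w + triple u v (jordan_mult c w)
      = (jordan_mult c u \<cdot> (v \<cdot> w) - u \<cdot> (jordan_mult c v \<cdot> w) + u \<cdot> (v \<cdot> jordan_mult c w))
      + (jordan_mult c w \<cdot> (v \<cdot> u) - w \<cdot> (jordan_mult c v \<cdot> u) + w \<cdot> (v \<cdot> jordan_mult c u))"
    by (simp add: triple_def algebra_simps)
  also have "\<dots> = (jordan_mult c (u \<cdot> (v \<cdot> w)) + ?defect u w)
      + (jordan_mult c (w \<cdot> (v \<cdot> u)) + ?defect w u)"
    unfolding half ..
  also have "\<dots> = jordan_mult c (triple u v w) + (?defect u w + ?defect w u)"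
    by (simp add: triple_def jordan_mult_def distribs algebra_simps)
  also have "?defect u w + ?defect w u = 0"
    using middle_Moufang_linear[of u c v w] by (simp add: algebra_simps)
  finally show ?thesis by simp
qed

text \<open>In an associative ring the commutator term is the commutator of \<open>x \<cdot> y - y \<cdot> x\<close> with
  \<open>z\<close>. In general it suffices to express all six left-bracketed products of \<open>x, y, z\<close>
  through right-bracketed ones and the single associator of \<open>x, y, z\<close>, whose multiples
  cancel.\<close>

lemma twice_triple:
  "triple x y z + triple x y z
    = jordan_mult x (jordan_mult y z) - jordan_mult y (jordan_mult x z)
      + jordan_mult (jordan_mult x y) z"
proof -
  have xyz: "(x \<cdot> y) \<cdot> z = associator x y z + x \<cdot> (y \<cdot> z)"
    by (simp add: associator_def)
  have yxz: "(y \<cdot> x) \<cdot> z = y \<cdot> (x \<cdot> z) - associator x y z"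
    using associator_swap_left[of x y z] by (simp add: associator_def algebra_simps)
  have zxy: "(z \<cdot> x) \<cdot> y = associator x y z + z \<cdot> (x \<cdot> y)"
    unfolding associator_rotate[of x y z] by (simp add: associator_def)
  have zyx: "(z \<cdot> y) \<cdot> x = z \<cdot> (y \<cdot> x) - associator x y z"
    unfolding associator_rotate[of y z x, symmetric] using associator_swap_left[of z y x]
    by (simp add: associator_def algebra_simps)
  have yzx: "(y \<cdot> z) \<cdot> x = associator x y z + y \<cdot> (z \<cdot> x)"
    unfolding associator_rotate[of y z x, symmetric] by (simp add: associator_def)
  have xzy: "(x \<cdot> z) \<cdot> y = x \<cdot> (z \<cdot> y) - associator x y z"
    using associator_swap_right[of x y z] by (simp add: associator_def algebra_simps)
  show ?thesis
    by (simp add: triple_def jordan_mult_def distribs xyz yxz zxy zyx yzx xzy)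
qed

lemma triple_add:
  "triple (a + b) v w = triple a v w + triple b v w"
  "triple u (a + b) w = triple u a w + triple u b w"
  "triple u v (a + b) = triple u v a + triple u v b"
  by (simp_all add: triple_def distribs algebra_simps)

lemma triple_diff:
  "triple (a - b) v w = triple a v w - triple b v w"
  "triple u (a - b) w = triple u a w - triple u b w"
  "triple u v (a - b) = triple u v a - triple u v b"
  by (simp_all add: triple_def distribs algebra_simps)

lemma jordan_mult_add: "jordan_mult c (a + b) = jordan_mult c a + jordan_mult c b"
  by (simp add: jordan_mult_def distribs algebra_simps)

lemma jordan_mult_diff: "jordan_mult c (a - b) = jordan_mult c a - jordan_mult c b"
  by (simp add: jordan_mult_def distribs algebra_simps)

text \<open>Twice the operator \<open>triple x y\<close> is a commutator of Jordan multiplications plus a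
  Jordan multiplication, so \<open>jordan_mult_triple\<close> can be applied to every term. In the
  commutator all terms in which the two multiplications hit different arguments cancel.\<close>

theorem jordan_triple_identity:
  "triple x y (triple u v w) - triple u v (triple x y w)
    = triple (triple x y u) v w - triple u (triple y x v) w"
proof -
  define lhs where "lhs = triple x y (triple u v w)"
  define rhs where "rhs = triple (triple x y u) v w - triple u (triple y x v) w
    + triple u v (triple x y w)"
  have "lhs + lhs =
     triple (triple x y u + triple x y u) v w - triple u (triple y x v + triple y x v) w
    + triple u v (triple x y w + triple x y w)"
    unfolding lhs_def twice_triple jordan_mult_commute[of y x]
    by (simp add: jordan_mult_triple jordan_mult_add jordan_mult_diff triple_add triple_diff
      algebra_simps)
  also have "\<dots> = rhs + rhs"
    by (simp add: rhs_def triple_add algebra_simps)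
  finally have "(lhs - rhs) + (lhs - rhs) = 0" by (simp add: algebra_simps)
  then have "lhs - rhs = 0" by (rule no_two_torsion)
  then show ?thesis by (simp add: lhs_def rhs_def algebra_simps)
qed

end

section \<open>The graded alternative ring of a Hom-alternative algebra\<close>

context multiplicative_hom_alternative_algebra
begin

lemma mult_additive:
  "\<mu> (a + b) c = \<mu> a c + \<mu> b c" "\<mu> a (b + c) = \<mu> a b + \<mu> a c"
  "\<alpha> (a + b) = \<alpha> a + \<alpha> b"
  using linear_mult_left linear_mult_right linear_twist by (simp_all add: Vector_Spaces.linear_iff)

lemma mult_scale:
  "\<mu> (scale r a) c = scale r (\<mu> a c)" "\<mu> a (scale r c) = scale r (\<mu> a c)"
  "\<alpha> (scale r a) = scale r (\<alpha> a)"
  using linear_mult_left linear_mult_right linear_twist by (simp_all add: Vector_Spaces.linear_iff)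

lemma mult_zero: "\<mu> 0 c = 0" "\<mu> a 0 = 0" "\<alpha> 0 = 0"
  using mult_scale(1)[of 0 0] mult_scale(2)[of _ 0 0] mult_scale(3)[of 0 0] by simp_all

lemma mult_sum:
  "\<mu> (sum f S) c = (\<Sum>i\<in>S. \<mu> (f i) c)" "\<mu> a (sum f S) = (\<Sum>i\<in>S. \<mu> a (f i))"
  by (induction S rule: infinite_finite_induct) (simp_all add: mult_zero mult_additive)

lemma twist_pow_add: "(\<alpha> ^^ n) (a + b) = (\<alpha> ^^ n) a + (\<alpha> ^^ n) b"
  by (induction n) (simp_all add: mult_additive)

lemma twist_pow_zero: "(\<alpha> ^^ n) 0 = 0"
  by (induction n) (simp_all add: mult_zero)

lemma twist_pow_sum: "(\<alpha> ^^ n) (sum f S) = (\<Sum>i\<in>S. (\<alpha> ^^ n) (f i))"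
  by (induction S rule: infinite_finite_induct) (simp_all add: twist_pow_zero twist_pow_add)

lemma twist_pow_mult: "(\<alpha> ^^ n) (\<mu> a b) = \<mu> ((\<alpha> ^^ n) a) ((\<alpha> ^^ n) b)"
  by (induction n) (simp_all add: twist_mult)

lemma twist_pow_twist_pow: "(\<alpha> ^^ m) ((\<alpha> ^^ n) a) = (\<alpha> ^^ (m + n)) a"
  by (simp add: funpow_add)

text \<open>The two adjacent transpositions generate all permutations, so they carry the whole
  antisymmetry.\<close>

lemma hom_associator_swap:
  "hom_associator b a c = - hom_associator a b c"
  "hom_associator a c b = - hom_associator a b c"
proof -
  define x where "x = (\<lambda>i::nat. if i = 0 then a else if i = 1 then b else c)"
  have "Transposition.transpose 0 1 permutes {0, 1, 2::nat}"
      "Transposition.transpose 1 2 permutes {0, 1, 2::nat}"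
    by (auto intro: permutes_swap_id)
  from this[THEN hom_associator_permute, of x]
  show "hom_associator b a c = - hom_associator a b c"
       "hom_associator a c b = - hom_associator a b c"
    by (simp_all add: x_def sign_swap_id Transposition.transpose_def)
qed

text \<open>Index \<open>i\<close> holds the component of degree \<open>i + 1\<close>. Thus indices combine to \<open>i + j + 1\<close>, and
  each factor is twisted by the index of the other one.\<close>

definition graded_mult :: "(nat \<Rightarrow> 'b) \<Rightarrow> (nat \<Rightarrow> 'b) \<Rightarrow> nat \<Rightarrow> 'b" where
  "graded_mult f g n = (\<Sum>(i, j) \<in> {(i, j). i + j + 1 = n}. \<mu> ((\<alpha> ^^ j) (f i)) ((\<alpha> ^^ i) (g j)))"

definition triples :: "nat \<Rightarrow> (nat \<times> nat \<times> nat) set" where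
  "triples n = {(i, j, k). i + j + k + 2 = n}"

lemma finite_pairs: "finite {(i, j). i + j + 1 = (n::nat)}"
  by (rule finite_subset[of _ "{..n} \<times> {..n}"]) auto

text \<open>Here the multiplicativity of the twist enters: it moves the outer twist through the
  inner product, after which each factor carries the sum of the other two indices, and the
  factor outside the inner product one further twist.\<close>

lemma graded_mult_left:
  "graded_mult (graded_mult f g) h n = (\<Sum>(i, j, k) \<in> triples n.
     \<mu> (\<mu> ((\<alpha> ^^ (j + k)) (f i)) ((\<alpha> ^^ (i + k)) (g j))) (\<alpha> ((\<alpha> ^^ (i + j)) (h k))))"
proof -
  have "graded_mult (graded_mult f g) h n =
    (\<Sum>(l, k) \<in> {(l, k). l + k + 1 = n}. \<Sum>(i, j) \<in> {(i, j). i + j + 1 = l}.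
     \<mu> (\<mu> ((\<alpha> ^^ (j + k)) (f i)) ((\<alpha> ^^ (i + k)) (g j))) (\<alpha> ((\<alpha> ^^ (i + j)) (h k))))"
    unfolding graded_mult_def
    by (intro sum.cong refl)
      (auto simp: twist_pow_sum mult_sum twist_pow_mult twist_pow_twist_pow add_ac intro!: sum.cong)
  also have "\<dots> = (\<Sum>((l, k), (i, j)) \<in>
      (SIGMA p:{(l, k). l + k + 1 = n}. {(i, j). i + j + 1 = fst p}).
     \<mu> (\<mu> ((\<alpha> ^^ (j + k)) (f i)) ((\<alpha> ^^ (i + k)) (g j))) (\<alpha> ((\<alpha> ^^ (i + j)) (h k))))"
    by (subst sum.Sigma[symmetric]) (auto simp: finite_pairs[simplified] intro!: sum.cong)
  also have "\<dots> = (\<Sum>(i, j, k) \<in> triples n.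
     \<mu> (\<mu> ((\<alpha> ^^ (j + k)) (f i)) ((\<alpha> ^^ (i + k)) (g j))) (\<alpha> ((\<alpha> ^^ (i + j)) (h k))))"
    by (rule sum.reindex_bij_witness[where i = "\<lambda>(i, j, k). ((i + j + 1, k), (i, j))"
          and j = "\<lambda>((l, k), (i, j)). (i, j, k)"]) (auto simp: triples_def)
  finally show ?thesis .
qed

lemma graded_mult_right:
  "graded_mult f (graded_mult g h) n = (\<Sum>(i, j, k) \<in> triples n.
     \<mu> (\<alpha> ((\<alpha> ^^ (j + k)) (f i))) (\<mu> ((\<alpha> ^^ (i + k)) (g j)) ((\<alpha> ^^ (i + j)) (h k))))"
proof -
  have "graded_mult f (graded_mult g h) n =
    (\<Sum>(i, l) \<in> {(i, l). i + l + 1 = n}. \<Sum>(j, k) \<in> {(j, k). j + k + 1 = l}.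
     \<mu> (\<alpha> ((\<alpha> ^^ (j + k)) (f i))) (\<mu> ((\<alpha> ^^ (i + k)) (g j)) ((\<alpha> ^^ (i + j)) (h k))))"
    unfolding graded_mult_def
    by (intro sum.cong refl)
      (auto simp: twist_pow_sum mult_sum twist_pow_mult twist_pow_twist_pow add_ac intro!: sum.cong)
  also have "\<dots> = (\<Sum>((i, l), (j, k)) \<in>
      (SIGMA p:{(i, l). i + l + 1 = n}. {(j, k). j + k + 1 = snd p}).
     \<mu> (\<alpha> ((\<alpha> ^^ (j + k)) (f i))) (\<mu> ((\<alpha> ^^ (i + k)) (g j)) ((\<alpha> ^^ (i + j)) (h k))))"
    by (subst sum.Sigma[symmetric]) (auto simp: finite_pairs[simplified] intro!: sum.cong)
  also have "\<dots> = (\<Sum>(i, j, k) \<in> triples n.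
     \<mu> (\<alpha> ((\<alpha> ^^ (j + k)) (f i))) (\<mu> ((\<alpha> ^^ (i + k)) (g j)) ((\<alpha> ^^ (i + j)) (h k))))"
    by (rule sum.reindex_bij_witness[where i = "\<lambda>(i, j, k). ((i, j + k + 1), (j, k))"
          and j = "\<lambda>((i, l), (j, k)). (i, j, k)"]) (auto simp: triples_def)
  finally show ?thesis .
qed

lemma graded_associator:
  "(graded_mult (graded_mult f g) h - graded_mult f (graded_mult g h)) n =
    (\<Sum>(i, j, k) \<in> triples n.
      hom_associator ((\<alpha> ^^ (j + k)) (f i)) ((\<alpha> ^^ (i + k)) (g j)) ((\<alpha> ^^ (i + j)) (h k)))"
  by (simp add: graded_mult_left graded_mult_right hom_associator_def sum_subtractf[symmetric]
      case_prod_unfold)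

lemma graded_associator_swap_left:
  "graded_mult (graded_mult f g) h - graded_mult f (graded_mult g h)
    = - (graded_mult (graded_mult g f) h - graded_mult g (graded_mult f h))"
proof
  fix n
  show "(graded_mult (graded_mult f g) h - graded_mult f (graded_mult g h)) n
    = (- (graded_mult (graded_mult g f) h - graded_mult g (graded_mult f h))) n"
    unfolding uminus_apply graded_associator sum_negf[symmetric]
    by (rule sum.reindex_bij_witness[where i = "\<lambda>(i, j, k). (j, i, k)"
          and j = "\<lambda>(i, j, k). (j, i, k)"])
      (auto simp: triples_def add_ac hom_associator_swap(1)[symmetric])
qed

lemma graded_associator_swap_right:
  "graded_mult (graded_mult f g) h - graded_mult f (graded_mult g h)
    = - (graded_mult (graded_mult f h) g - graded_mult f (graded_mult h g))"
proof
  fix n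
  show "(graded_mult (graded_mult f g) h - graded_mult f (graded_mult g h)) n
    = (- (graded_mult (graded_mult f h) g - graded_mult f (graded_mult h g))) n"
    unfolding uminus_apply graded_associator sum_negf[symmetric]
    by (rule sum.reindex_bij_witness[where i = "\<lambda>(i, j, k). (i, k, j)"
          and j = "\<lambda>(i, j, k). (i, k, j)"])
      (auto simp: triples_def add_ac hom_associator_swap(2)[symmetric])
qed

lemma vector_no_two_torsion: "a + a = 0 \<Longrightarrow> a = (0::'b)"
proof -
  assume "a + a = 0"
  then have "scale (1 + 1) a = 0" by (simp only: scale_left_distrib scale_one)
  then show "a = 0" by simp
qed

lemma graded_mult_additive:
  "graded_mult (f + g) h = graded_mult f h + graded_mult g h"
  "graded_mult f (g + h) = graded_mult f g + graded_mult f h"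
  by (rule ext, simp add: graded_mult_def twist_pow_add mult_additive sum.distrib[symmetric]
      case_prod_unfold)+

sublocale graded: alternative_ring graded_mult
proof (unfold_locales, goal_cases)
  case (5 f)
  then have "f n + f n = 0" for n by (metis plus_fun_apply zero_fun_apply)
  then have "f n = 0" for n by (rule vector_no_two_torsion)
  then show ?case by (simp add: fun_eq_iff)
qed (rule graded_mult_additive graded_associator_swap_left graded_associator_swap_right)+

definition homogeneous :: "nat \<Rightarrow> 'b \<Rightarrow> nat \<Rightarrow> 'b" where
  "homogeneous i a = (\<lambda>k. if k = i then a else 0)"

lemma graded_mult_homogeneous:
  "graded_mult (homogeneous i a) (homogeneous j b)
    = homogeneous (i + j + 1) (\<mu> ((\<alpha> ^^ j) a) ((\<alpha> ^^ i) b))"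
proof
  fix n
  let ?term = "\<lambda>(k, l). \<mu> ((\<alpha> ^^ l) (homogeneous i a k)) ((\<alpha> ^^ k) (homogeneous j b l))"
  have zero: "?term p = 0" if "p \<noteq> (i, j)" for p
    using that by (auto simp: homogeneous_def mult_zero twist_pow_zero split: prod.split)
  have "graded_mult (homogeneous i a) (homogeneous j b) n
      = (\<Sum>p \<in> {(k, l). k + l + 1 = n} \<inter> {(i, j)}. ?term p)"
    unfolding graded_mult_def
  proof (rule sum.mono_neutral_right)
    show "finite {(k, l). k + l + 1 = n}" by (rule finite_pairs)
    show "\<forall>p \<in> {(k, l). k + l + 1 = n} - {(k, l). k + l + 1 = n} \<inter> {(i, j)}. ?term p = 0"
      using zero by blast
  qed blast
  then show "graded_mult (homogeneous i a) (homogeneous j b) n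
      = homogeneous (i + j + 1) (\<mu> ((\<alpha> ^^ j) a) ((\<alpha> ^^ i) b)) n"
    by (cases "n = i + j + 1") (auto simp: homogeneous_def Int_insert_right)
qed

lemma homogeneous_add: "homogeneous i a + homogeneous i b = homogeneous i (a + b)"
  by (auto simp: homogeneous_def)

definition hom_triple :: "'b \<Rightarrow> 'b \<Rightarrow> 'b \<Rightarrow> 'b" where
  "hom_triple x y z = \<mu> (\<alpha> x) (\<mu> y z) + \<mu> (\<alpha> z) (\<mu> y x)"

lemma graded_triple:
  "graded.triple (homogeneous i x) (homogeneous j y) (homogeneous k z)
   = homogeneous (i + j + k + 2)
      (hom_triple ((\<alpha> ^^ (j + k)) x) ((\<alpha> ^^ (i + k)) y) ((\<alpha> ^^ (i + j)) z))"
  by (simp add: graded.triple_def graded_mult_homogeneous twist_pow_mult twist_pow_twist_pow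
      homogeneous_add hom_triple_def add_ac)

text \<open>Elements of degree 1 sit at index 0, so a five-fold product lies at index 4. There the
  inner triple product is at index 2, which puts the second power of the twist on the two
  outer arguments, while two arguments of index 0 contribute no twist to it.\<close>

lemma hom_triple_identity:
  "hom_triple ((\<alpha> ^^ 2) x) ((\<alpha> ^^ 2) y) (hom_triple u v w)
      - hom_triple ((\<alpha> ^^ 2) u) ((\<alpha> ^^ 2) v) (hom_triple x y w)
    = hom_triple (hom_triple x y u) ((\<alpha> ^^ 2) v) ((\<alpha> ^^ 2) w)
      - hom_triple ((\<alpha> ^^ 2) u) (hom_triple y x v) ((\<alpha> ^^ 2) w)"
proof -
  let ?e = "homogeneous 0"
  have "(graded.triple (?e x) (?e y) (graded.triple (?e u) (?e v) (?e w))
        - graded.triple (?e u) (?e v) (graded.triple (?e x) (?e y) (?e w))) 4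
      = (graded.triple (graded.triple (?e x) (?e y) (?e u)) (?e v) (?e w)
        - graded.triple (?e u) (graded.triple (?e y) (?e x) (?e v)) (?e w)) 4"
    by (simp only: graded.jordan_triple_identity)
  then show ?thesis
    by (simp add: graded_triple) (simp add: homogeneous_def numeral_2_eq_2)
qed

lemma hom_triple_scale:
  "hom_triple (scale r x) y z = scale r (hom_triple x y z)"
  "hom_triple x (scale r y) z = scale r (hom_triple x y z)"
  "hom_triple x y (scale r z) = scale r (hom_triple x y z)"
  by (simp_all add: hom_triple_def mult_scale scale_right_distrib)

lemma hom_triple_add:
  "hom_triple (a + b) y z = hom_triple a y z + hom_triple b y z"
  "hom_triple x (a + b) z = hom_triple x a z + hom_triple x b z"
  "hom_triple x y (a + b) = hom_triple x y a + hom_triple x y b"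
  by (simp_all add: hom_triple_def mult_additive algebra_simps)

lemma hom_triple_commute: "hom_triple x y z = hom_triple z y x"
  by (simp add: hom_triple_def add.commute)

lemma hom_jordan_triple:
  "multiplicative_hom_jordan_triple_system scale
    (\<lambda>x y z. scale (1 / 2) (hom_triple x y z)) (\<alpha> ^^ 2) (\<alpha> ^^ 2)"
proof
  fix x y z u v w
  show "scale (1 / 2) (hom_triple ((\<alpha> ^^ 2) x) ((\<alpha> ^^ 2) y) (scale (1 / 2) (hom_triple u v w)))
      - scale (1 / 2) (hom_triple ((\<alpha> ^^ 2) u) ((\<alpha> ^^ 2) v) (scale (1 / 2) (hom_triple x y w)))
    = scale (1 / 2) (hom_triple (scale (1 / 2) (hom_triple x y u)) ((\<alpha> ^^ 2) v) ((\<alpha> ^^ 2) w))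
      - scale (1 / 2) (hom_triple ((\<alpha> ^^ 2) u) (scale (1 / 2) (hom_triple y x v)) ((\<alpha> ^^ 2) w))"
    by (simp only: hom_triple_scale scale_right_diff_distrib[symmetric] hom_triple_identity)
  show "scale (1 / 2) (hom_triple x y z) = scale (1 / 2) (hom_triple z y x)"
    by (simp only: hom_triple_commute)
  show "(\<alpha> ^^ 2) (scale (1 / 2) (hom_triple x y z))
      = scale (1 / 2) (hom_triple ((\<alpha> ^^ 2) x) ((\<alpha> ^^ 2) y) ((\<alpha> ^^ 2) z))"
    by (simp add: numeral_2_eq_2 hom_triple_def mult_scale mult_additive twist_mult)
qed (simp_all add: hom_triple_add hom_triple_scale scale_right_distrib
      numeral_2_eq_2 mult_additive mult_scale)

end

theorem corollary4p5:
  fixes scale :: "'k::field_char_0 \<Rightarrow> 'a::ab_group_add \<Rightarrow> 'a"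
    and \<mu> :: "'a \<Rightarrow> 'a \<Rightarrow> 'a"
    and \<alpha> :: "'a \<Rightarrow> 'a"
  assumes "multiplicative_hom_alternative_algebra scale \<mu> \<alpha>"
  shows "multiplicative_hom_jordan_triple_system scale
    (\<lambda>x y z. scale (1 / 2) (\<mu> (\<alpha> x) (\<mu> y z) + \<mu> (\<alpha> z) (\<mu> y x)))
    (\<alpha> ^^ 2) (\<alpha> ^^ 2)"
proof -
  interpret multiplicative_hom_alternative_algebra scale \<mu> \<alpha> by fact
  show ?thesis using hom_jordan_triple unfolding hom_triple_def .
qed

end
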